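(* If there is a multiple $\mathfrak{d}$-pathway, then there is a $\mathsf{P}$-point.
   Context: An ultrafilter on $\omega$ (always non-principal) is a $\mathsf{P}$-point if every countable subfamily of $\mathcal{U}$ has a pseudointersection in $\mathcal{U}$, i.e. there is a set in $\mathcal{U}$ which is almost contained (contained modulo a finite set) in every member of the subfamily. For $f,g\in\omega^\omega$, $f\le^* g$ means $f(n)\le g(n)$ for all but finitely many $n$. For a regular cardinal $\kappa>\omega_1$, $\mathsf{H}(\kappa)$ is the collection of all sets whose transitive closure has size less than $\kappa$; a well order $\trianglelefteq$ of $\mathsf{H}(\kappa)$ is fixed, and $\mathsf{Sub}(\kappa)$ is the set of all countable $M\subseteq\mathsf{H}(\kappa)$ such that $(M,\in,\trianglelefteq)$ is an elementary submodel of $(\mathsf{H}(\kappa),\in,\trianglelefteq)$. The height of $M$ is $\delta_M=M\cap\omega_1$, a countable ordinal. A finite sequence $\langle M_0,\dots,M_n\rangle$ of such models is $\delta$-increasing if $\delta_{M_i}\le\delta_{M_{i+1}}$ for each $i<n$. A relation $R\subseteq X^{n}\times\omega^\omega$ is $\le^*$-adequate if for all $x_1,\dots,x_n\in X$ there is $f\in\omega^\omega$ such that for every increasing $g\in\omega^\omega$, if $g\not\le^* f$ then $R(x_1,\dots,x_n,g)$ holds. Let $\kappa>\mathfrak{c}$ be a regular cardinal, $\mathcal{B}=\{f_\alpha\mid\alpha<\omega_1\}\subseteq\omega^\omega$ an indexed family of increasing functions, and $\mathcal{S}\subseteq\mathsf{Sub}(\kappa)$ a stationary subset of $[\mathsf{H}(\kappa)]^\omega$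 such that $\mathcal{B}\in M$ for every $M\in\mathcal{S}$. The pair $(\mathcal{B},\mathcal{S})$ is a multiple $\mathfrak{d}$-pathway if for every $\delta$-increasing sequence $\langle M_0,\dots,M_n\rangle$ of models from $\mathcal{S}$, every projective $\le^*$-adequate relation $R\subseteq(\omega^\omega)^{n+2}$ with $R\in M_n$, and all $x_i\in M_i\cap\omega^\omega$ ($i\le n$), $R(x_0,\dots,x_n,f_{\delta_{M_n}})$ holds. *)

theory Defs
  imports "HOL-Analysis.Analysis"
begin

unbundle cardinal_syntax


section \<open>An ambient universe of sets\<close>

text \<open>
  The type \<open>'k hset\<close> consists of all well-founded sets that are hereditarily of size at most
  \<open>|UNIV :: 'k set|\<close>.  It is obtained from the well-founded trees with branching indexed by (subsets
  of) \<open>'k\<close> by identifying bisimilar trees.  As this universe is transitive and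
  closed under subsets of size at most \<open>|UNIV :: 'k set|\<close>, for every cardinal \<open>\<kappa> :: 'k rel\<close> it
  contains every set whose transitive closure has size less than \<open>\<kappa>\<close>.
\<close>

datatype 'k tree = Node (branch: "'k \<Rightarrow> 'k tree option")

inductive bisim :: "'k tree \<Rightarrow> 'k tree \<Rightarrow> bool" where
  "\<lbrakk>\<forall>x\<in>ran F. \<exists>y\<in>ran G. bisim x y; \<forall>y\<in>ran G. \<exists>x\<in>ran F. bisim x y\<rbrakk>
    \<Longrightarrow> bisim (Node F) (Node G)"

lemma bisim_Node_iff:
  "bisim (Node F) (Node G) \<longleftrightarrow>
    (\<forall>x\<in>ran F. \<exists>y\<in>ran G. bisim x y) \<and> (\<forall>y\<in>ran G. \<exists>x\<in>ran F. bisim x y)"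
  by (subst bisim.simps) auto

lemma bisim_refl: "bisim x x"
proof (induction x)
  case (Node F)
  have "bisim y y" if y: "y \<in> ran F" for y
  proof -
    from y obtain a where a: "F a = Some y" by (auto simp: ran_def)
    show ?thesis by (rule Node.IH[of "F a" y]) (simp_all add: a flip: a)
  qed
  then show ?case by (auto simp: bisim_Node_iff)
qed

lemma bisim_sym: "bisim x y \<Longrightarrow> bisim y x"
  by (induction rule: bisim.induct) (auto simp: bisim_Node_iff)

lemma bisim_trans: "bisim x y \<Longrightarrow> bisim y z \<Longrightarrow> bisim x z"
proof (induction arbitrary: z rule: bisim.induct)
  case (1 F G)
  obtain H where z: "z = Node H" by (cases z)
  from 1 show ?case unfolding z bisim_Node_iff by meson
qed

quotient_type 'k hset = "'k tree" / bisim
  by (rule equivpI) (auto intro!: reflpI sympI transpI intro: bisim_refl bisim_sym bisim_trans)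

definition elts :: "'k hset \<Rightarrow> 'k hset set" where
  "elts x = abs_hset ` ran (branch (rep_hset x))"

definition hmem :: "'k hset rel" where
  "hmem = {(y, x). y \<in> elts x}"

text \<open>The set with a given extension (meaningful for extensions of size at most \<open>|UNIV :: 'k set|\<close>).\<close>

definition vset :: "'k hset set \<Rightarrow> 'k hset" where
  "vset A = (THE x. elts x = A)"

lemma abs_hset_eq_iff: "abs_hset x = abs_hset y \<longleftrightarrow> bisim x y"
  using Quotient3_rel[OF Quotient3_hset, of x y] by (simp add: bisim_refl)

lemma abs_rep_hset: "abs_hset (rep_hset x) = x"
  by (rule Quotient3_abs_rep[OF Quotient3_hset])

lemma elts_abs: "elts (abs_hset t) = abs_hset ` ran (branch t)"
proof -
  obtain F G where F: "rep_hset (abs_hset t) = Node F" and G: "t = Node G"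
    by (meson tree.exhaust)
  have "bisim (rep_hset (abs_hset t)) t"
    by (simp add: abs_rep_hset flip: abs_hset_eq_iff)
  then have *: "\<forall>x\<in>ran F. \<exists>y\<in>ran G. abs_hset x = abs_hset y"
      "\<forall>y\<in>ran G. \<exists>x\<in>ran F. abs_hset x = abs_hset y"
    unfolding F unfolding G bisim_Node_iff abs_hset_eq_iff by (rule conjunct1, rule conjunct2)
  have "abs_hset ` ran F = abs_hset ` ran G"
  proof (intro equalityI subsetI; elim imageE)
    fix z x assume "z = abs_hset x" "x \<in> ran F"
    then show "z \<in> abs_hset ` ran G" using *(1) by (metis imageI)
  next
    fix z y assume "z = abs_hset y" "y \<in> ran G"
    then show "z \<in> abs_hset ` ran F" using *(2) by (metis imageI)
  qed
  then show ?thesis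
    unfolding elts_def F by (simp add: G)
qed

lemma hset_eqI: 
  assumes "elts x = elts y" shows "x = y"
proof -
  obtain F G where F: "rep_hset x = Node F" and G: "rep_hset y = Node G"
    by (meson tree.exhaust)
  have *: "abs_hset ` ran F = abs_hset ` ran G"
    using assms by (simp add: elts_def F G)
  have "bisim (Node F) (Node G)"
    unfolding bisim_Node_iff
  proof (intro conjI ballI)
    fix t assume "t \<in> ran F"
    then have "abs_hset t \<in> abs_hset ` ran G" unfolding *[symmetric] by (rule imageI)
    then show "\<exists>u\<in>ran G. bisim t u" by (auto simp: abs_hset_eq_iff)
  next
    fix u assume "u \<in> ran G"
    then have "abs_hset u \<in> abs_hset ` ran F" unfolding * by (rule imageI)
    then show "\<exists>t\<in>ran F. bisim t u" by (auto simp: abs_hset_eq_iff) (metis bisim_sym)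
  qed
  then show ?thesis
    using abs_hset_eq_iff[of "Node F" "Node G"] abs_rep_hset[of x] abs_rep_hset[of y] by (simp add: F G)
qed

lemma hset_induct: 
  assumes step: "\<And>x. (\<And>y. y \<in> elts x \<Longrightarrow> P y) \<Longrightarrow> P x"
  shows "P x"
proof -
  have "P (abs_hset t)" for t
  proof (induction t)
    case (Node F)
    have "P (abs_hset y)" if y: "y \<in> ran F" for y
    proof -
      from y obtain a where a: "F a = Some y" by (auto simp: ran_def)
      show ?thesis by (rule Node.IH[of "F a" y]) (simp_all add: a flip: a)
    qed
    then show ?case by - (rule step, auto simp: elts_abs)
  qed
  from this[of "rep_hset x"] show ?thesis by (simp add: abs_rep_hset)
qed

lemma wf_hmem: "wf hmem"
proof (rule wfUNIVI)
  fix P :: "'k hset \<Rightarrow> bool" and x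
  assume "\<forall>x. (\<forall>y. (y, x) \<in> hmem \<longrightarrow> P y) \<longrightarrow> P x"
  then show "P x"
    by (induction x rule: hset_induct) (auto simp: hmem_def)
qed

lemma elts_card_le: "|elts (x :: 'k hset)| \<le>o |UNIV :: 'k set|"
proof -
  define g where "g a = abs_hset (the (branch (rep_hset x) a))" for a
  have "elts x \<subseteq> range g"
  proof
    fix y assume "y \<in> elts x"
    then obtain a t where "branch (rep_hset x) a = Some t" "y = abs_hset t"
      by (auto simp: elts_def ran_def)
    then show "y \<in> range g" by (intro range_eqI[of _ _ a]) (simp add: g_def)
  qed
  then show ?thesis
    by (rule ordLeq_transitive[OF card_of_mono1 card_of_image])
qed

lemma elts_vset:
  fixes A :: "'k hset set"
  assumes "|A| \<le>o |UNIV :: 'k set|"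
  shows "elts (vset A) = A"
proof -
  obtain h :: "'k hset \<Rightarrow> 'k" where h: "inj_on h A"
    using assms by (auto simp flip: card_of_ordLeq)
  define F where "F = (\<lambda>a. if a \<in> h ` A then Some (rep_hset (the_inv_into A h a)) else None)"
  have F: "F (h x) = Some (rep_hset x)" if "x \<in> A" for x
    using h that by (simp add: F_def the_inv_into_f_f)
  have "ran F = rep_hset ` A"
  proof
    show "ran F \<subseteq> rep_hset ` A"
      using h by (auto simp: ran_def F_def the_inv_into_f_f split: if_splits)
    show "rep_hset ` A \<subseteq> ran F"
      using F by (auto intro: ranI)
  qed
  then have *: "elts (abs_hset (Node F)) = A"
    by (simp add: elts_abs image_image abs_rep_hset)
  have "vset A = abs_hset (Node F)"
    unfolding vset_def
  proof (rule the_equality)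
    show "x = abs_hset (Node F)" if "elts x = A" for x
      using that * by (intro hset_eqI) simp
  qed (rule *)
  then show ?thesis using * by simp
qed


section \<open>Set-theoretic codes of the objects that may belong to a model\<close>

definition vpair :: "'k hset \<Rightarrow> 'k hset \<Rightarrow> 'k hset" where
  "vpair x y = vset {vset {x}, vset {x, y}}"

primrec vnat :: "nat \<Rightarrow> 'k hset" where
  "vnat 0 = vset {}"
| "vnat (Suc n) = vset (insert (vnat n) (elts (vnat n)))"

definition vreal :: "(nat \<Rightarrow> nat) \<Rightarrow> 'k hset" where
  "vreal x = vset (range (\<lambda>n. vpair (vnat n) (vnat (x n))))"

text \<open>
  Elements of \<open>(\<omega>\<^sup>\<omega>)\<^sup>k\<close> are the extensional functions in \<open>{..<k} \<rightarrow>\<^sub>E UNIV\<close>; their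
  codes are functions with domain the natural number \<open>k\<close>.
\<close>

definition vtuple :: "nat \<Rightarrow> (nat \<Rightarrow> nat \<Rightarrow> nat) \<Rightarrow> 'k hset" where
  "vtuple k t = vset ((\<lambda>i. vpair (vnat i) (vreal (t i))) ` {..<k})"

definition vrel :: "nat \<Rightarrow> (nat \<Rightarrow> nat \<Rightarrow> nat) set \<Rightarrow> 'k hset" where
  "vrel k R = vset (vtuple k ` R)"

definition vtransitive :: "'k hset \<Rightarrow> bool" where
  "vtransitive x \<longleftrightarrow> (\<forall>y\<in>elts x. elts y \<subseteq> elts x)"

definition vord :: "'k hset \<Rightarrow> bool" where
  "vord x \<longleftrightarrow> vtransitive x \<and> (\<forall>y\<in>elts x. vtransitive y)"

definition omega1 :: "'k hset" where
  "omega1 = vset {\<alpha>. vord \<alpha> \<and> countable (elts \<alpha>)}"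

text \<open>The indexed family \<open>\<langle>f \<alpha> | \<alpha> < \<omega>\<^sub>1\<rangle>\<close>, as a function with domain \<open>\<omega>\<^sub>1\<close>.\<close>

definition vfamily :: "('k hset \<Rightarrow> nat \<Rightarrow> nat) \<Rightarrow> 'k hset" where
  "vfamily f = vset ((\<lambda>\<alpha>. vpair \<alpha> (vreal (f \<alpha>))) ` elts omega1)"

lemma ord_iso_imp_eq:
  assumes "vtransitive \<alpha>" "vtransitive \<beta>"
    and bij: "bij_betw \<phi> (elts \<alpha>) (elts \<beta>)"
    and mem: "\<And>x y. x \<in> elts \<alpha> \<Longrightarrow> y \<in> elts \<alpha> \<Longrightarrow> \<phi> x \<in> elts (\<phi> y) \<longleftrightarrow> x \<in> elts y"
  shows "\<alpha> = \<beta>"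
proof -
  have fixed: "x \<in> elts \<alpha> \<longrightarrow> \<phi> x = x" for x
  proof (induction x rule: hset_induct)
    case (1 x)
    show ?case
    proof
      assume x: "x \<in> elts \<alpha>"
      then have sub: "elts x \<subseteq> elts \<alpha>" using assms(1) by (auto simp: vtransitive_def)
      have "\<phi> x \<in> elts \<beta>" using x bij by (auto simp: bij_betw_def)
      then have sub': "elts (\<phi> x) \<subseteq> \<phi> ` elts \<alpha>"
        using assms(2) bij by (auto simp: vtransitive_def bij_betw_def)
      have eq: "\<phi> y = y" if "y \<in> elts x" for y using 1 that sub by blast
      have "elts (\<phi> x) = elts x"
      proof
        show "elts x \<subseteq> elts (\<phi> x)"
          using mem[OF _ x] sub eq by (metis subset_iff)
        show "elts (\<phi> x) \<subseteq> elts x"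
        proof
          fix z assume z: "z \<in> elts (\<phi> x)"
          with sub' obtain y where y: "y \<in> elts \<alpha>" "z = \<phi> y" by blast
          with z mem[OF _ x] have "y \<in> elts x" by blast
          with y eq show "z \<in> elts x" by simp
        qed
      qed
      then show "\<phi> x = x" by (rule hset_eqI)
    qed
  qed
  have "elts \<beta> = \<phi> ` elts \<alpha>" using bij by (simp add: bij_betw_def)
  also have "\<dots> = elts \<alpha>" using fixed by simp
  finally show ?thesis using hset_eqI by metis
qed

lemma card_countable_ords_le:
  "|{\<alpha> :: 'k hset. vord \<alpha> \<and> countable (elts \<alpha>)}| \<le>o |UNIV :: nat set set|"
proof -
  let ?A = "{\<alpha> :: 'k hset. vord \<alpha> \<and> countable (elts \<alpha>)}"
  define g where "g \<alpha> = to_nat_on (elts \<alpha>)" for \<alpha> :: "'k hset"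
  define c where "c \<alpha> = (g \<alpha> ` elts \<alpha>, {(g \<alpha> x, g \<alpha> y) | x y. x \<in> elts \<alpha> \<and> y \<in> elts \<alpha> \<and> x \<in> elts y})"
    for \<alpha> :: "'k hset"
  have "inj_on c ?A"
  proof (rule inj_onI)
    fix \<alpha> \<beta> :: "'k hset" assume A: "\<alpha> \<in> ?A" "\<beta> \<in> ?A" and eq: "c \<alpha> = c \<beta>"
    have inj: "inj_on (g \<alpha>) (elts \<alpha>)" "inj_on (g \<beta>) (elts \<beta>)"
      using A by (auto simp: g_def)
    have im: "g \<alpha> ` elts \<alpha> = g \<beta> ` elts \<beta>"
      and rel: "{(g \<alpha> x, g \<alpha> y) | x y. x \<in> elts \<alpha> \<and> y \<in> elts \<alpha> \<and> x \<in> elts y}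
              = {(g \<beta> x, g \<beta> y) | x y. x \<in> elts \<beta> \<and> y \<in> elts \<beta> \<and> x \<in> elts y}"
      using eq by (auto simp: c_def)
    define \<phi> where "\<phi> = the_inv_into (elts \<beta>) (g \<beta>) \<circ> g \<alpha>"
    have bij: "bij_betw \<phi> (elts \<alpha>) (elts \<beta>)"
      unfolding \<phi>_def
      by (rule bij_betw_trans[of _ _ "g \<beta> ` elts \<beta>"])
        (use inj im in \<open>auto simp: bij_betw_def inj_on_the_inv_into\<close>)
    have g\<phi>: "g \<beta> (\<phi> x) = g \<alpha> x" and \<phi>in: "\<phi> x \<in> elts \<beta>" if "x \<in> elts \<alpha>" for x
    proof -
      have "g \<alpha> x \<in> g \<beta> ` elts \<beta>" using that im by blast
      then show "g \<beta> (\<phi> x) = g \<alpha> x" by (simp add: \<phi>_def f_the_inv_into_f[OF inj(2)])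
      show "\<phi> x \<in> elts \<beta>" using bij that by (auto simp: bij_betw_def)
    qed
    have m1: "(g \<alpha> x, g \<alpha> y) \<in> {(g \<alpha> x, g \<alpha> y) | x y. x \<in> elts \<alpha> \<and> y \<in> elts \<alpha> \<and> x \<in> elts y} \<longleftrightarrow> x \<in> elts y"
      if "x \<in> elts \<alpha>" "y \<in> elts \<alpha>" for x y
      using that inj(1) by (auto dest: inj_onD)
    have m2: "(g \<beta> x, g \<beta> y) \<in> {(g \<beta> x, g \<beta> y) | x y. x \<in> elts \<beta> \<and> y \<in> elts \<beta> \<and> x \<in> elts y} \<longleftrightarrow> x \<in> elts y"
      if "x \<in> elts \<beta>" "y \<in> elts \<beta>" for x y
      using that inj(2) by (auto dest: inj_onD)
    have "\<phi> x \<in> elts (\<phi> y) \<longleftrightarrow> x \<in> elts y" if "x \<in> elts \<alpha>" "y \<in> elts \<alpha>" for x y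
      using m1[OF that] m2[OF \<phi>in[OF that(1)] \<phi>in[OF that(2)]] unfolding rel
      by (simp only: g\<phi>[OF that(1)] g\<phi>[OF that(2)])
    then show "\<alpha> = \<beta>"
      using ord_iso_imp_eq[OF _ _ bij] A by (auto simp: vord_def)
  qed
  then have le: "|?A| \<le>o |UNIV :: (nat set \<times> (nat \<times> nat) set) set|"
    by (auto simp flip: card_of_ordLeq)
  define e :: "nat set \<times> (nat \<times> nat) set \<Rightarrow> nat set" where
    "e p = (case p of (X, Y) \<Rightarrow> (\<lambda>n. 2 * n) ` X \<union> (\<lambda>q. 2 * prod_encode q + 1) ` Y)" for p
  have "X = X' \<and> Y = Y'" if "e (X, Y) = e (X', Y')" for X Y X' Y'
  proof -
    have "n \<in> Z \<longleftrightarrow> 2 * n \<in> e (Z, W)" and "q \<in> W \<longleftrightarrow> 2 * prod_encode q + 1 \<in> e (Z, W)" for n q Z W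
      by (auto simp: e_def image_iff) presburger+
    with that show ?thesis by blast
  qed
  then have "inj e" by (auto simp: inj_on_def)
  then have "|UNIV :: (nat set \<times> (nat \<times> nat) set) set| \<le>o |UNIV :: nat set set|"
    by (auto simp flip: card_of_ordLeq)
  with le show ?thesis by (rule ordLeq_transitive)
qed

lemma elts_omega1:
  assumes "|UNIV :: nat set set| \<le>o |UNIV :: 'k set|"
  shows "elts (omega1 :: 'k hset) = {\<alpha>. vord \<alpha> \<and> countable (elts \<alpha>)}"
  unfolding omega1_def by (rule elts_vset) (rule ordLeq_transitive[OF card_countable_ords_le assms])


section \<open>The structure of sets of hereditary size less than \<open>\<kappa>\<close>, and elementary submodels\<close>

definition trcl :: "'k hset \<Rightarrow> 'k hset set" where
  "trcl x = {y. (y, x) \<in> hmem\<^sup>+}"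

definition H :: "'k rel \<Rightarrow> 'k hset set" where
  "H \<kappa> = {x. |trcl x| <o \<kappa>}"

text \<open>
  First-order formulas over the signature of \<open>\<in>\<close> and \<open>\<unlhd>\<close>; variables are named by natural numbers.
\<close>

datatype fm = Eq nat nat | Mem nat nat | Wle nat nat | Neg fm | Conj fm fm | Ex nat fm

primrec sat :: "'k hset rel \<Rightarrow> 'k hset set \<Rightarrow> (nat \<Rightarrow> 'k hset) \<Rightarrow> fm \<Rightarrow> bool" where
  "sat W D e (Eq i j) \<longleftrightarrow> e i = e j"
| "sat W D e (Mem i j) \<longleftrightarrow> e i \<in> elts (e j)"
| "sat W D e (Wle i j) \<longleftrightarrow> (e i, e j) \<in> W"
| "sat W D e (Neg \<phi>) \<longleftrightarrow> \<not> sat W D e \<phi>"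
| "sat W D e (Conj \<phi> \<psi>) \<longleftrightarrow> sat W D e \<phi> \<and> sat W D e \<psi>"
| "sat W D e (Ex i \<phi>) \<longleftrightarrow> (\<exists>a\<in>D. sat W D (e(i := a)) \<phi>)"

definition elementary_submodel :: "'k hset rel \<Rightarrow> 'k hset set \<Rightarrow> 'k hset set \<Rightarrow> bool" where
  "elementary_submodel W M D \<longleftrightarrow> M \<noteq> {} \<and> M \<subseteq> D \<and>
    (\<forall>\<phi> e. range e \<subseteq> M \<longrightarrow> (sat W M e \<phi> \<longleftrightarrow> sat W D e \<phi>))"

definition Sub :: "'k rel \<Rightarrow> 'k hset rel \<Rightarrow> 'k hset set set" where
  "Sub \<kappa> W = {M. M \<subseteq> H \<kappa> \<and> countable M \<and> elementary_submodel W M (H \<kappa>)}"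

definition height :: "'k hset set \<Rightarrow> 'k hset" where
  "height M = vset (M \<inter> elts omega1)"

text \<open>The order of ordinals is inclusion.\<close>

definition delta_increasing :: "nat \<Rightarrow> (nat \<Rightarrow> 'k hset set) \<Rightarrow> bool" where
  "delta_increasing n M \<longleftrightarrow> (\<forall>i<n. elts (height (M i)) \<subseteq> elts (height (M (Suc i))))"


section \<open>Stationary sets\<close>

definition ctbl_subsets :: "'a set \<Rightarrow> 'a set set" where
  "ctbl_subsets A = {X. X \<subseteq> A \<and> countable X \<and> infinite X}"

definition club :: "'a set \<Rightarrow> 'a set set \<Rightarrow> bool" where
  "club A C \<longleftrightarrow> C \<subseteq> ctbl_subsets A \<and>
    (\<forall>X\<in>ctbl_subsets A. \<exists>Y\<in>C. X \<subseteq> Y) \<and>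
    (\<forall>Y :: nat \<Rightarrow> 'a set. range Y \<subseteq> C \<and> mono Y \<longrightarrow> (\<Union>n. Y n) \<in> C)"

definition stationary :: "'a set \<Rightarrow> 'a set set \<Rightarrow> bool" where
  "stationary A S \<longleftrightarrow> S \<subseteq> ctbl_subsets A \<and> (\<forall>C. club A C \<longrightarrow> S \<inter> C \<noteq> {})"


section \<open>Projective and adequate relations\<close>

abbreviation baire_power :: "nat \<Rightarrow> (nat \<Rightarrow> nat \<Rightarrow> nat) set" where
  "baire_power k \<equiv> {..<k} \<rightarrow>\<^sub>E UNIV"

abbreviation baire_topology :: "nat \<Rightarrow> (nat \<Rightarrow> nat \<Rightarrow> nat) topology" where
  "baire_topology k \<equiv> product_topology (\<lambda>_. euclidean) {..<k}"

definition last_proj :: "nat \<Rightarrow> (nat \<Rightarrow> nat \<Rightarrow> nat) set \<Rightarrow> (nat \<Rightarrow> nat \<Rightarrow> nat) set" where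
  "last_proj k A = (\<lambda>t. restrict t {..<k}) ` A"

text \<open>\<open>Sigma1 m k\<close> is the class of boldface \<open>\<Sigma>\<^sup>1\<^bsub>m + 1\<^esub>\<close> subsets of \<open>(\<omega>\<^sup>\<omega>)\<^sup>k\<close>.\<close>

primrec Sigma1 :: "nat \<Rightarrow> nat \<Rightarrow> (nat \<Rightarrow> nat \<Rightarrow> nat) set set" where
  "Sigma1 0 k = {last_proj k C | C. closedin (baire_topology (Suc k)) C}"
| "Sigma1 (Suc m) k = {last_proj k (baire_power (Suc k) - A) | A. A \<in> Sigma1 m (Suc k)}"

definition projective :: "nat \<Rightarrow> (nat \<Rightarrow> nat \<Rightarrow> nat) set \<Rightarrow> bool" where
  "projective k R \<longleftrightarrow> (\<exists>m. R \<in> Sigma1 m k)"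

definition le_star :: "(nat \<Rightarrow> nat) \<Rightarrow> (nat \<Rightarrow> nat) \<Rightarrow> bool"  (infix \<open>\<le>\<^sup>*\<close> 50) where
  "f \<le>\<^sup>* g \<longleftrightarrow> finite {n. \<not> f n \<le> g n}"

text \<open>Here \<open>R \<subseteq> (\<omega>\<^sup>\<omega>)\<^sup>k \<times> \<omega>\<^sup>\<omega>\<close> is regarded as a subset of \<open>(\<omega>\<^sup>\<omega>)\<^bsup>k + 1\<^esup>\<close>.\<close>

definition adequate :: "nat \<Rightarrow> (nat \<Rightarrow> nat \<Rightarrow> nat) set \<Rightarrow> bool" where
  "adequate k R \<longleftrightarrow> R \<subseteq> baire_power (Suc k) \<and>
    (\<forall>x\<in>baire_power k. \<exists>f. \<forall>g. strict_mono g \<and> \<not> g \<le>\<^sup>* f \<longrightarrow> x(k := g) \<in> R)"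


section \<open>Multiple d-pathways and P-points\<close>

text \<open>
  Increasing functions in \<open>\<omega>\<^sup>\<omega>\<close> are strictly increasing, both here and in the definition of adequacy.
  The reals and relations quantified over below are HOL objects; membership in a model
  refers to their codes.  The cardinal of the continuum is \<open>|UNIV :: nat set set|\<close>.
\<close>

definition multiple_d_pathway ::
    "'k rel \<Rightarrow> 'k hset rel \<Rightarrow> ('k hset \<Rightarrow> nat \<Rightarrow> nat) \<Rightarrow> 'k hset set set \<Rightarrow> bool" where
  "multiple_d_pathway \<kappa> W f S \<longleftrightarrow>
    Card_order \<kappa> \<and> regularCard \<kappa> \<and> |UNIV :: nat set set| <o \<kappa> \<and>
    well_order_on (H \<kappa>) W \<and>
    (\<forall>\<alpha>\<in>elts omega1. strict_mono (f \<alpha>)) \<and>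
    S \<subseteq> Sub \<kappa> W \<and> stationary (H \<kappa>) S \<and> (\<forall>M\<in>S. vfamily f \<in> M) \<and>
    (\<forall>n M R x.
      (\<forall>i\<le>n. M i \<in> S) \<and> delta_increasing n M \<and>
      projective (n + 2) R \<and> adequate (n + 1) R \<and> vrel (n + 2) R \<in> M n \<and>
      (\<forall>i\<le>n. vreal (x i) \<in> M i)
      \<longrightarrow> (\<lambda>i\<in>{..<n + 2}. if i \<le> n then x i else f (height (M n))) \<in> R)"

definition nonprincipal_ultrafilter :: "'a filter \<Rightarrow> bool" where
  "nonprincipal_ultrafilter \<U> \<longleftrightarrow> \<U> \<noteq> bot \<and>
    (\<forall>A. (\<forall>\<^sub>F n in \<U>. n \<in> A) \<or> (\<forall>\<^sub>F n in \<U>. n \<notin> A)) \<and>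
    (\<forall>a. \<not> (\<forall>\<^sub>F n in \<U>. n = a))"

definition P_point :: "nat filter \<Rightarrow> bool" where
  "P_point \<U> \<longleftrightarrow> nonprincipal_ultrafilter \<U> \<and>
    (\<forall>\<A> :: nat set set. countable \<A> \<and> (\<forall>A\<in>\<A>. \<forall>\<^sub>F n in \<U>. n \<in> A) \<longrightarrow>
      (\<exists>B. (\<forall>\<^sub>F n in \<U>. n \<in> B) \<and> (\<forall>A\<in>\<A>. finite (B - A))))"

end

theory Submission
  imports Defs
begin

text \<open>
  For \<open>x\<close> coding a sequence of sets \<open>slice x l\<close>, the set \<open>diag x h\<close> is a pseudointersection of them.
  By recursion on \<open>\<delta>\<close>, choose an ultrafilter \<open>V \<delta>\<close> containing all sets \<open>diag x (f \<alpha>)\<close> where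
  \<open>\<alpha> < \<delta>\<close>, \<open>x\<close> lies in a model of height \<open>\<alpha>\<close>, and every \<open>slice x l\<close> belongs to \<open>V \<alpha>\<close>.
  That finitely many of these sets have infinite intersection is the pathway property for the
  analytic relation saying that if all finite intersections of the slices involved are infinite,
  then so is the intersection of the diagonal intersections along the last coordinate.  It is
  adequate: given \<open>c k \<ge> k\<close> in the slices up to \<open>k\<close>, a strictly increasing \<open>g\<close> that
  exceeds \<open>c\<close> at \<open>k\<close> has \<open>c k\<close> in the diagonal intersection.
  An ultrafilter containing all the generated sets is a P-point, since every real lies in a model.

  No definability argument is needed to see that the relevant relations belong to the models:
  \<open>S\<close> may be intersected with the club of sets closed under countably many given operations.
\<close>


section \<open>Ultrafilters\<close>

text \<open>Zorn's lemma gives a minimal proper filter below \<open>F\<close>. Its meet with the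
  principal filter of \<open>A\<close> is either improper, so that the complement of
  \<open>A\<close> belongs to it, or equal to it by minimality.\<close>

lemma ex_ultrafilter_le:
  fixes F :: "'a filter"
  assumes "F \<noteq> bot"
  obtains U where "U \<le> F" "U \<noteq> bot"
    "\<And>A. (\<forall>\<^sub>F n in U. n \<in> A) \<or> (\<forall>\<^sub>F n in U. n \<notin> A)"
proof -
  let ?A = "{G. G \<le> F \<and> G \<noteq> bot}"
  let ?P = "\<lambda>G G' :: 'a filter. G' \<le> G"
  have "\<exists>m\<in>?A. \<forall>a\<in>?A. ?P m a \<longrightarrow> a = m"
  proof (rule predicate_Zorn)
    show "partial_order_on ?A (relation_of ?P ?A)"
      by (rule partial_order_on_relation_ofI) auto
  next
    fix C assume C: "C \<in> Chains (relation_of ?P ?A)"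
    show "\<exists>u\<in>?A. \<forall>a\<in>C. ?P a u"
    proof (cases "C = {}")
      case True
      with assms show ?thesis by auto
    next
      case False
      have tot: "G \<le> G' \<or> G' \<le> G" if "G \<in> C" "G' \<in> C" for G G'
        using C that unfolding Chains_def relation_of_def by blast
      have CA: "C \<subseteq> ?A"
        using C unfolding Chains_def relation_of_def by blast
      \<comment> \<open>A nonempty chain is a filter base, so its infimum is improper only if one of
        its members is.\<close>
      have "\<not> eventually (\<lambda>_. False) (Inf C)"
      proof (subst eventually_Inf_base[OF False])
        show "\<exists>x\<in>C. x \<le> inf G G'" if "G \<in> C" "G' \<in> C" for G G'
          using tot[OF that] that by (auto simp: inf_absorb1 inf_absorb2)
        show "\<not> (\<exists>G\<in>C. \<forall>\<^sub>F _ in G. False)"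
          using CA by (auto simp: trivial_limit_def)
      qed
      then have "Inf C \<noteq> bot" by (auto simp: trivial_limit_def)
      moreover have "Inf C \<le> F"
        using False CA by (auto intro: Inf_lower2)
      ultimately show ?thesis by (auto intro: Inf_lower)
    qed
  qed
  then obtain U where U: "U \<le> F" "U \<noteq> bot" and
    min: "\<And>G. G \<le> U \<Longrightarrow> G \<noteq> bot \<Longrightarrow> G = U"
    by (auto intro: order_trans)
  have "(\<forall>\<^sub>F n in U. n \<in> A) \<or> (\<forall>\<^sub>F n in U. n \<notin> A)" for A
  proof (cases "inf U (principal A) = bot")
    case True
    then have "\<forall>\<^sub>F n in inf U (principal A). False" by simp
    then show ?thesis by (simp add: eventually_inf_principal)
  next
    case False
    then have "inf U (principal A) = U" by (intro min) auto
    moreover have "\<forall>\<^sub>F n in inf U (principal A). n \<in> A"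
      by (simp add: eventually_inf_principal)
    ultimately show ?thesis by simp
  qed
  with U that show ?thesis by blast
qed

text \<open>Since finite intersections are infinite, the family stays proper when the cofinite
  filter is added, and this filter excludes principal ultrafilters.\<close>

lemma ex_nonprincipal_ultrafilter:
  fixes \<G> :: "'a set set"
  assumes "\<And>X. X \<subseteq> \<G> \<Longrightarrow> finite X \<Longrightarrow> infinite (\<Inter>X)"
  shows "\<exists>\<U>. nonprincipal_ultrafilter \<U> \<and> (\<forall>A\<in>\<G>. \<forall>\<^sub>F n in \<U>. n \<in> A)"
proof -
  let ?F = "\<lambda>A. inf cofinite (principal A)"
  \<comment> \<open>\<open>UNIV\<close> contributes the cofinite filter itself, also when \<G> is
    empty.\<close>
  have "(INF A\<in>insert UNIV \<G>. ?F A) \<noteq> bot"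
  proof (rule INF_filter_not_bot)
    fix X assume X: "X \<subseteq> insert UNIV \<G>" "finite X"
    have "?F (\<Inter>X) \<le> (INF A\<in>X. ?F A)"
      by (intro INF_greatest inf_mono) auto
    moreover have "infinite (\<Inter>X)"
    proof -
      have "\<Inter>X = \<Inter>(X - {UNIV})" by auto
      then show ?thesis using assms[of "X - {UNIV}"] X by auto
    qed
    then have "?F (\<Inter>X) \<noteq> bot"
      by (simp add: trivial_limit_def eventually_inf_principal eventually_cofinite
          del: Inter_iff)
    ultimately show "(INF A\<in>X. ?F A) \<noteq> bot"
      using bot_unique by metis
  qed
  then obtain U where U: "U \<le> (INF A\<in>insert UNIV \<G>. ?F A)" "U \<noteq> bot"
    "\<And>A. (\<forall>\<^sub>F n in U. n \<in> A) \<or> (\<forall>\<^sub>F n in U. n \<notin> A)"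
    by (rule ex_ultrafilter_le) blast
  have le: "U \<le> ?F A" if "A \<in> insert UNIV \<G>" for A
    using U(1) that by (rule order_trans[OF _ INF_lower])
  have "U \<le> cofinite" using le[of UNIV] by simp
  then have "\<forall>\<^sub>F n in U. n \<noteq> a" for a
    by (rule filter_leD) (simp add: eventually_cofinite)
  then have "\<not> (\<forall>\<^sub>F n in U. n = a)" for a
    using U(2) eventually_conj[of "\<lambda>n. n = a" U "\<lambda>n. n \<noteq> a"] by (auto simp: trivial_limit_def)
  moreover have "\<forall>\<^sub>F n in U. n \<in> A" if "A \<in> \<G>" for A
    using le[of A] that by (auto simp: filter_leD eventually_principal)
  ultimately show ?thesis
    using U unfolding nonprincipal_ultrafilter_def by blast
qed

lemma nonprincipal_ultrafilter_imp_infinite: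
  assumes U: "nonprincipal_ultrafilter \<U>" and A: "\<forall>\<^sub>F n in \<U>. n \<in> A"
  shows "infinite A"
proof
  assume "finite A"
  have "\<forall>\<^sub>F n in \<U>. n \<noteq> a" for a
  proof -
    have "(\<forall>\<^sub>F n in \<U>. n \<in> {a}) \<or> (\<forall>\<^sub>F n in \<U>. n \<notin> {a})"
      using U unfolding nonprincipal_ultrafilter_def by blast
    then show ?thesis using U unfolding nonprincipal_ultrafilter_def by simp
  qed
  then have "\<forall>\<^sub>F n in \<U>. \<forall>a\<in>A. n \<noteq> a"
    using \<open>finite A\<close> by (intro eventually_ball_finite) auto
  with A have "\<forall>\<^sub>F n in \<U>. False" by eventually_elim auto
  then show False
    using U unfolding nonprincipal_ultrafilter_def trivial_limit_def by blast
qed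


section \<open>Diagonal intersections\<close>

definition slice :: "(nat \<Rightarrow> nat) \<Rightarrow> nat \<Rightarrow> nat set" where
  "slice x l = {j. x (prod_encode (l, j)) \<noteq> 0}"

definition of_slices :: "(nat \<Rightarrow> nat set) \<Rightarrow> nat \<Rightarrow> nat" where
  "of_slices A p = (case prod_decode p of (l, j) \<Rightarrow> if j \<in> A l then 1 else 0)"

lemma slice_of_slices [simp]: "slice (of_slices A) l = A l"
  by (simp add: slice_def of_slices_def)

text \<open>
  For strictly increasing \<open>h\<close> the bound \<open>l \<le> j\<close> is no restriction; it makes membership of \<open>j\<close> a
  clopen condition on \<open>x\<close> and \<open>h\<close>.
\<close>

definition diag :: "(nat \<Rightarrow> nat) \<Rightarrow> (nat \<Rightarrow> nat) \<Rightarrow> nat set" where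
  "diag x h = {j. \<forall>l\<le>j. j < h l \<or> j \<in> slice x l}"

text \<open>A member \<open>j\<close> of the diagonal intersection with \<open>l \<le> j\<close> and
  \<open>h l \<le> j\<close> lies in \<open>slice x l\<close>; only smaller ones can escape.\<close>

lemma finite_diag_minus_slice: "finite (diag x h - slice x l)"
proof (rule finite_subset)
  show "diag x h - slice x l \<subseteq> {..< max (h l) l}"
    by (auto simp: diag_def not_le) (metis not_le less_max_iff_disj)
qed simp

text \<open>The functions \<open>hs\<close> are those attached to the models of smaller height, which are already
  available as parameters; the remaining diagonal intersections use the last coordinate.\<close>

definition past_slice :: "(nat \<Rightarrow> nat) list \<Rightarrow> (nat \<Rightarrow> nat \<Rightarrow> nat) \<Rightarrow> nat \<Rightarrow> nat \<Rightarrow> nat set" where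
  "past_slice hs t i l = (if i < length hs then diag (t i) (hs ! i) else slice (t i) l)"

text \<open>An implication written as a disjunction: either some finite intersection of the sets
  involved is finite, or the diagonal intersections have infinite intersection. The functions
  \<open>hs\<close> are parameters rather than coordinates, since a pathway supplies only the
  function at the height of the last model.\<close>

definition diag_rel :: "nat \<Rightarrow> (nat \<Rightarrow> nat) list \<Rightarrow> (nat \<Rightarrow> nat \<Rightarrow> nat) set" where
  "diag_rel n hs = {t \<in> baire_power (n + 2).
     (\<exists>k m. \<forall>j\<ge>m. \<exists>i\<le>n. \<exists>l\<le>k. j \<notin> past_slice hs t i l) \<or>
     (\<forall>m. \<exists>j\<ge>m. \<forall>i\<le>n. j \<in> diag (t i) (if i < length hs then hs ! i else t (Suc n)))}"

lemma adequate_diag_rel: "adequate (n + 1) (diag_rel n hs)"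
  unfolding adequate_def
proof (intro conjI ballI)
  show "diag_rel n hs \<subseteq> baire_power (Suc (n + 1))"
    by (auto simp: diag_rel_def)
next
  fix x :: "nat \<Rightarrow> nat \<Rightarrow> nat" assume x: "x \<in> baire_power (n + 1)"
  have upd: "x(n + 1 := g) \<in> baire_power (n + 2)"
    "i \<le> n \<Longrightarrow> past_slice hs (x(n + 1 := g)) i l = past_slice hs x i l" for g i l
    using x by (auto simp: PiE_iff extensional_def past_slice_def)
  show "\<exists>f. \<forall>g. strict_mono g \<and> \<not> g \<le>\<^sup>* f \<longrightarrow> x(n + 1 := g) \<in> diag_rel n hs"
  proof (cases "\<exists>k m. \<forall>j\<ge>m. \<exists>i\<le>n. \<exists>l\<le>k. j \<notin> past_slice hs x i l")
    \<comment> \<open>The first disjunct does not look at the last coordinate, so every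
      \<open>g\<close> is good.\<close>
    case True
    then have "x(n + 1 := g) \<in> diag_rel n hs" for g
      using upd unfolding diag_rel_def by (smt (verit) mem_Collect_eq)
    then show ?thesis by blast
  next
    case False
    then have "\<forall>k. \<exists>j\<ge>k. \<forall>i\<le>n. \<forall>l\<le>k. j \<in> past_slice hs x i l" by blast
    then obtain c where c: "\<And>k. c k \<ge> k" "\<And>k i l. i \<le> n \<Longrightarrow> l \<le> k \<Longrightarrow> c k \<in> past_slice hs x i l"
      by metis
    show ?thesis
    proof (intro exI allI impI)
      fix g assume g: "strict_mono g \<and> \<not> g \<le>\<^sup>* c"
      let ?t = "x(n + 1 := g)"
      have "\<exists>j\<ge>m. \<forall>i\<le>n. j \<in> diag (?t i) (if i < length hs then hs ! i else ?t (Suc n))" for m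
      proof -
        have "infinite {k. c k < g k}" using g by (simp add: le_star_def not_le)
        then obtain k where k: "k \<ge> m" "c k < g k"
          unfolding infinite_nat_iff_unbounded_le by blast
        have "c k \<in> diag (x i) g" if i: "i \<le> n" "\<not> i < length hs" for i
          unfolding diag_def
        proof (intro CollectI allI impI)
          fix l
          show "c k < g l \<or> c k \<in> slice (x i) l"
          \<comment> \<open>Up to \<open>k\<close> the choice of \<open>c k\<close> decides; beyond
            \<open>k\<close> monotonicity gives \<open>c k < g k \<le> g l\<close>.\<close>
          proof (cases "l \<le> k")
            case True
            then show ?thesis using c(2)[OF i(1)] i(2) by (auto simp: past_slice_def)
          next
            case False
            then have "g k \<le> g l" using g by (simp add: strict_mono_less_eq)
            with k show ?thesis by simp
          qed
        qed
        moreover have "c k \<in> diag (x i) (hs ! i)" if "i \<le> n" "i < length hs" for i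
          using c(2)[OF that(1) order_refl, of k] that(2) by (simp add: past_slice_def)
        ultimately show ?thesis
          using c(1)[of k] k(1) by (intro exI[of _ "c k"]) auto
      qed
      then show "?t \<in> diag_rel n hs"
        using upd(1) unfolding diag_rel_def by blast
    qed
  qed
qed

section \<open>Closed conditions on tuples of reals, and the analyticity of
  \<open>diag_rel\<close>\<close>

definition closed_pred :: "nat \<Rightarrow> ((nat \<Rightarrow> nat \<Rightarrow> nat) \<Rightarrow> bool) \<Rightarrow> bool" where
  "closed_pred k P \<longleftrightarrow> closedin (baire_topology k) {t \<in> baire_power k. P t}"

lemma closed_pred_const: "closed_pred k (\<lambda>t. c)"
proof -
  have "baire_power k = topspace (baire_topology k)" by simp
  then show ?thesis
    unfolding closed_pred_def by (cases c) (simp_all del: topspace_product_topology)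
qed

text \<open>A single value \<open>t i p\<close> depends continuously on \<open>t\<close> and ranges
  over a discrete space, so every condition on it is clopen; in particular atomic conditions may be
  negated.\<close>

lemma closed_pred_coord:
  assumes "i < k"
  shows "closed_pred k (\<lambda>t. Q (t i p))"
proof -
  have "continuous_on UNIV (\<lambda>x :: nat \<Rightarrow> nat. x p)" by simp
  then have "closed ((\<lambda>x :: nat \<Rightarrow> nat. x p) -` Collect Q)"
    by (rule closed_vimage[rotated]) (simp add: closed_def open_discrete)
  then have "closedin euclidean ((\<lambda>x :: nat \<Rightarrow> nat. x p) -` Collect Q)" by simp
  moreover have "continuous_map (baire_topology k) euclidean (\<lambda>t. t i)"
    using assms by (intro continuous_map_product_projection) simp
  ultimately show ?thesis
    using closedin_continuous_map_preimage by (fastforce simp: closed_pred_def)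
qed

lemma closed_pred_disj:
  assumes "closed_pred k P" "closed_pred k Q"
  shows "closed_pred k (\<lambda>t. P t \<or> Q t)"
proof -
  have "{t \<in> baire_power k. P t \<or> Q t} = {t \<in> baire_power k. P t} \<union> {t \<in> baire_power k. Q t}"
    by auto
  with assms show ?thesis by (simp add: closed_pred_def closedin_Un)
qed

lemma closed_pred_all:
  assumes "\<And>a. closed_pred k (P a)"
  shows "closed_pred k (\<lambda>t. \<forall>a. P a t)"
proof -
  have "{t \<in> baire_power k. \<forall>a. P a t} = (\<Inter>a. {t \<in> baire_power k. P a t})" by auto
  with assms show ?thesis by (auto simp: closed_pred_def)
qed

lemma closed_pred_imp:
  "(A \<Longrightarrow> closed_pred k P) \<Longrightarrow> closed_pred k (\<lambda>t. A \<longrightarrow> P t)"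
  using closed_pred_const[of k True] by (cases A) auto

lemma closed_pred_conj:
  assumes "closed_pred k P" "closed_pred k Q"
  shows "closed_pred k (\<lambda>t. P t \<and> Q t)"
proof -
  have "closed_pred k (\<lambda>t. \<forall>b. if b then P t else Q t)"
  proof (rule closed_pred_all)
    show "closed_pred k (\<lambda>t. if b then P t else Q t)" for b
      using assms by (cases b) simp_all
  qed
  then show ?thesis by (simp add: all_bool_eq)
qed

lemma closed_pred_bex:
  fixes n :: nat
  assumes "\<And>i. i \<le> n \<Longrightarrow> closed_pred k (P i)"
  shows "closed_pred k (\<lambda>t. \<exists>i\<le>n. P i t)"
proof -
  have "{t \<in> baire_power k. \<exists>i\<le>n. P i t} = (\<Union>i\<le>n. {t \<in> baire_power k. P i t})" by auto
  moreover have "closedin (baire_topology k) (\<Union>i\<le>n. {t \<in> baire_power k. P i t})"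
    using assms by (intro closedin_Union) (auto simp: closed_pred_def)
  ultimately show ?thesis by (simp add: closed_pred_def)
qed

text \<open>One further coordinate absorbs the unbounded existential quantifiers. The remaining
  quantifiers are universal or bounded, so the relation is the projection of a closed set.\<close>

lemma projective_diag_rel: "projective (n + 2) (diag_rel n hs)"
proof -
  let ?k = "Suc (n + 2)"
  let ?d = "\<lambda>t i. diag (t i) (if i < length hs then hs ! i else t (Suc n))"
  txt \<open>The last coordinate \<open>w = t (n + 2)\<close> is a witness: \<open>w 0\<close> selects the disjunct, \<open>w 1\<close> and
    \<open>w 2\<close> bound the failure in the first one, and \<open>w (m + 1)\<close> is a Skolem function for the second.\<close>
  define P where "P t \<longleftrightarrow>
      (t (n + 2) 0 = 0 \<and>
        (\<forall>k m. t (n + 2) 1 \<noteq> k \<or> t (n + 2) 2 \<noteq> m \<or>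
          (\<forall>j. m \<le> j \<longrightarrow> (\<exists>i\<le>n. \<exists>l\<le>k. j \<notin> past_slice hs t i l)))) \<or>
      (t (n + 2) 0 \<noteq> 0 \<and>
        (\<forall>m j. t (n + 2) (Suc m) \<noteq> j \<or> (m \<le> j \<and> (\<forall>i. i \<le> n \<longrightarrow> j \<in> ?d t i))))" for t
  have co: "closed_pred ?k (\<lambda>t. Q (t i p))" if "i \<le> n + 2" for Q i p
    using that by (intro closed_pred_coord) simp
  have neg: "closed_pred ?k (\<lambda>t. j \<notin> past_slice hs t i l)" if i: "i \<le> n" for j i l
  proof (cases "i < length hs")
    case True
    \<comment> \<open>The bound \<open>l \<le> j\<close> in \<open>diag\<close> makes this negation
      a finite union.\<close>
    have "closed_pred ?k (\<lambda>t. \<exists>l\<le>j. \<not> j < (hs ! i) l \<and> \<not> t i (prod_encode (l, j)) \<noteq> 0)"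
      using i by (intro closed_pred_bex co) simp
    with True show ?thesis by (simp add: past_slice_def diag_def slice_def)
  next
    case False
    have "closed_pred ?k (\<lambda>t. t i (prod_encode (l, j)) = 0)"
      using i by (intro co) simp
    with False show ?thesis by (simp add: past_slice_def slice_def)
  qed
  have dia: "closed_pred ?k (\<lambda>t. j \<in> ?d t i)" if i: "i \<le> n" for j i
  proof (cases "i < length hs")
    case True
    have "closed_pred ?k (\<lambda>t. \<forall>l. l \<le> j \<longrightarrow> j < (hs ! i) l \<or> t i (prod_encode (l, j)) \<noteq> 0)"
      using i by (intro closed_pred_all closed_pred_imp co) simp
    with True show ?thesis by (simp add: diag_def slice_def)
  next
    case False
    have "closed_pred ?k (\<lambda>t. \<forall>l. l \<le> j \<longrightarrow> j < t (Suc n) l \<or> t i (prod_encode (l, j)) \<noteq> 0)"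
      using i by (intro closed_pred_all closed_pred_imp closed_pred_disj co) simp_all
    with False show ?thesis by (simp add: diag_def slice_def)
  qed
  \<comment> \<open>In \<open>P\<close> the values of the witness are compared with all constants,
    and for fixed constants each condition is closed.\<close>
  have "closed_pred ?k P"
    unfolding P_def
    by (intro closed_pred_disj closed_pred_conj closed_pred_all closed_pred_imp closed_pred_bex
        neg dia closed_pred_const co) auto
  moreover have "diag_rel n hs = last_proj (n + 2) {t \<in> baire_power ?k. P t}"
  proof (intro equalityI subsetI)
    fix t assume t: "t \<in> diag_rel n hs"
    have "\<exists>w. P (t(n + 2 := w))"
    proof (cases "\<exists>k m. \<forall>j\<ge>m. \<exists>i\<le>n. \<exists>l\<le>k. j \<notin> past_slice hs t i l")
      case True
      then obtain k m where "\<forall>j\<ge>m. \<exists>i\<le>n. \<exists>l\<le>k. j \<notin> past_slice hs t i l" by blast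
      moreover have "past_slice hs (t(n + 2 := w)) i l = past_slice hs t i l" if "i \<le> n" for w i l
        using that by (simp add: past_slice_def)
      ultimately have "\<forall>j\<ge>m. \<exists>i\<le>n. \<exists>l\<le>k. j \<notin> past_slice hs (t(n + 2 := w)) i l" for w
        by metis
      then show ?thesis
        by (intro exI[of _ "\<lambda>p. if p = 0 then 0 else if p = 1 then k else m"])
          (simp add: P_def)
    next
      case False
      with t have "\<forall>m. \<exists>j\<ge>m. \<forall>i\<le>n. j \<in> ?d t i" by (simp add: diag_rel_def)
      then obtain c where c: "\<And>m. m \<le> c m" "\<And>m i. i \<le> n \<Longrightarrow> c m \<in> ?d t i" by metis
      have "c m \<in> diag (t i) (hs ! i)" if "i \<le> n" "i < length hs" for m i
        using c(2)[OF that(1), of m] that(2) by simp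
      moreover have "c m \<in> diag (t i) (t (Suc n))" if "i \<le> n" "\<not> i < length hs" for m i
        using c(2)[OF that(1), of m] that(2) by simp
      ultimately show ?thesis
        by (intro exI[of _ "\<lambda>p. if p = 0 then 1 else c (p - 1)"])
          (auto simp: P_def c(1))
    qed
    then obtain w where w: "P (t(n + 2 := w))" ..
    have ext: "t \<in> baire_power (n + 2)" using t by (simp add: diag_rel_def)
    then have "t(n + 2 := w) \<in> baire_power ?k"
      by (auto simp: PiE_iff extensional_def)
    moreover have "t = restrict (t(n + 2 := w)) {..<n + 2}"
      using ext by (auto simp: fun_eq_iff PiE_iff extensional_def restrict_def)
    ultimately show "t \<in> last_proj (n + 2) {t \<in> baire_power ?k. P t}"
      using w unfolding last_proj_def by blast
  next
    fix t assume "t \<in> last_proj (n + 2) {t \<in> baire_power ?k. P t}"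
    then obtain s where s: "P s" "t = restrict s {..<n + 2}" by (auto simp: last_proj_def)
    have ts: "t i = s i" if "i \<le> Suc n" for i using that s(2) by simp
    have pr: "past_slice hs t i l = past_slice hs s i l" "?d t i = ?d s i" if "i \<le> n" for i l
      using that ts by (simp_all add: past_slice_def)
    from s(1) consider
      "\<forall>j\<ge>s (n + 2) 2. \<exists>i\<le>n. \<exists>l\<le>s (n + 2) 1. j \<notin> past_slice hs s i l"
      | "\<forall>m. m \<le> s (n + 2) (Suc m) \<and> (\<forall>i\<le>n. s (n + 2) (Suc m) \<in> ?d s i)"
      unfolding P_def by blast
    then have "(\<exists>k m. \<forall>j\<ge>m. \<exists>i\<le>n. \<exists>l\<le>k. j \<notin> past_slice hs t i l) \<or>
        (\<forall>m. \<exists>j\<ge>m. \<forall>i\<le>n. j \<in> ?d t i)"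
      by cases (metis pr(1), metis pr(2))
    moreover have "t \<in> baire_power (n + 2)" using s(2) by auto
    ultimately show "t \<in> diag_rel n hs" by (simp add: diag_rel_def)
  qed
  ultimately have "diag_rel n hs \<in> Sigma1 0 (n + 2)"
    by (auto simp: closed_pred_def)
  then show ?thesis unfolding projective_def by blast
qed


section \<open>Codes of hereditary size at most continuum\<close>

lemma trcl_eq: "trcl x = elts x \<union> (\<Union>y\<in>elts x. trcl y)"
proof -
  have "(y, x) \<in> hmem\<^sup>+ \<longleftrightarrow> y \<in> elts x \<or> (\<exists>z\<in>elts x. (y, z) \<in> hmem\<^sup>+)" for y
    by (subst trancl.simps) (auto simp: hmem_def)
  then show ?thesis unfolding trcl_def by blast
qed

abbreviation continuum :: "nat set rel" where
  "continuum \<equiv> |UNIV :: nat set set|"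

text \<open>This class is closed under forming sets of at most continuum many members, and so
  contains the codes of reals and of relations. As the continuum is below \<kappa>, it is included
  in \<open>H \<kappa>\<close>.\<close>

definition hered_continuum :: "'k hset set" where
  "hered_continuum = {x. |trcl x| \<le>o continuum}"

lemma countable_ordLeq_continuum: "countable A \<Longrightarrow> |A| \<le>o continuum"
  by (rule ordLeq_transitive[of _ "|UNIV :: nat set|"])
    (auto simp flip: card_of_ordLeq simp: countable_def intro: exI[of _ "\<lambda>n. {n}"])

lemma card_reals_ordLeq_continuum: "|A :: (nat \<Rightarrow> nat \<Rightarrow> nat) set| \<le>o continuum"
proof -
  define e :: "(nat \<Rightarrow> nat \<Rightarrow> nat) \<Rightarrow> nat set" where
    "e t = {prod_encode (i, prod_encode (j, t i j)) | i j. True}" for t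
  have "inj e"
  proof (rule injI)
    fix s t assume eq: "e s = e t"
    have "prod_encode (i, prod_encode (j, s i j)) \<in> e t" for i j
      unfolding eq[symmetric] by (auto simp: e_def)
    then show "s = t" by (auto simp: e_def fun_eq_iff)
  qed
  then have "inj_on e A" by (rule inj_on_subset) simp
  then show ?thesis by (auto simp flip: card_of_ordLeq)
qed

context
  assumes large: "continuum \<le>o |UNIV :: 'k set|"
begin

lemma elts_vset_continuum:
  "|A :: 'k hset set| \<le>o continuum \<Longrightarrow> elts (vset A) = A"
  by (rule elts_vset) (rule ordLeq_transitive[OF _ large])

lemma elts_vset_countable: "countable A \<Longrightarrow> elts (vset A :: 'k hset) = A"
  by (intro elts_vset_continuum countable_ordLeq_continuum)

lemma vset_in_hered_continuum:
  assumes "A \<subseteq> hered_continuum" "|A :: 'k hset set| \<le>o continuum"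
  shows "vset A \<in> hered_continuum"
proof -
  have inf: "infinite (UNIV :: nat set set)"
    by (simp add: Finite_Set.finite_set)
  have "|\<Union>y\<in>A. trcl y| \<le>o continuum"
    using assms by (intro card_of_UNION_ordLeq_infinite[OF inf]) (auto simp: hered_continuum_def)
  with assms(2) have "|A \<union> (\<Union>y\<in>A. trcl y)| \<le>o continuum"
    using inf by (intro card_of_Un_ordLeq_infinite_Field card_of_Card_order) (auto simp: Field_card_of)
  then show ?thesis
    using elts_vset_continuum[OF assms(2)] by (simp add: hered_continuum_def trcl_eq[of "vset A"])
qed

lemma vset_countable_in_hered_continuum:
  "A \<subseteq> hered_continuum \<Longrightarrow> countable A \<Longrightarrow> (vset A :: 'k hset) \<in> hered_continuum"
  by (intro vset_in_hered_continuum countable_ordLeq_continuum)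

lemma vpair_in_hered_continuum:
  "x \<in> hered_continuum \<Longrightarrow> y \<in> hered_continuum \<Longrightarrow> (vpair x y :: 'k hset) \<in> hered_continuum"
  unfolding vpair_def by (intro vset_countable_in_hered_continuum) (auto intro!: vset_countable_in_hered_continuum)

lemma elts_vnat: "elts (vnat n :: 'k hset) = vnat ` {..<n}"
  by (induction n) (auto simp: elts_vset_countable lessThan_Suc)

lemma vnat_in_hered_continuum: "(vnat n :: 'k hset) \<in> hered_continuum"
proof (induction n rule: less_induct)
  case (less n)
  have "vnat n = (vset (vnat ` {..<n}) :: 'k hset)"
    by (rule hset_eqI) (simp add: elts_vnat elts_vset_countable)
  with less show ?case by (auto intro!: vset_countable_in_hered_continuum)
qed

lemma vreal_in_hered_continuum: "(vreal x :: 'k hset) \<in> hered_continuum"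
  unfolding vreal_def
  by (intro vset_countable_in_hered_continuum)
    (auto intro!: vpair_in_hered_continuum vnat_in_hered_continuum)

lemma vrel_in_hered_continuum: "(vrel k R :: 'k hset) \<in> hered_continuum"
proof -
  have "(vtuple k t :: 'k hset) \<in> hered_continuum" for t
    unfolding vtuple_def
    by (intro vset_countable_in_hered_continuum)
      (auto intro!: vpair_in_hered_continuum vnat_in_hered_continuum vreal_in_hered_continuum)
  then show ?thesis
    unfolding vrel_def
    by (intro vset_in_hered_continuum)
      (auto intro: ordLeq_transitive[OF card_of_image card_reals_ordLeq_continuum])
qed

lemma vset_inject:
  "countable A \<Longrightarrow> countable B \<Longrightarrow> vset A = (vset B :: 'k hset) \<longleftrightarrow> A = B"
  by (metis elts_vset_countable)

lemma vpair_inject: "vpair x y = (vpair x' y' :: 'k hset) \<longleftrightarrow> x = x' \<and> y = y'"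
  by (auto simp: vpair_def vset_inject doubleton_eq_iff)

lemma inj_vnat: "inj (vnat :: nat \<Rightarrow> 'k hset)"
proof (rule linorder_injI)
  fix m n :: nat assume "m < n"
  then have "(vnat m, vnat n :: 'k hset) \<in> hmem" by (auto simp: hmem_def elts_vnat)
  then show "vnat m \<noteq> (vnat n :: 'k hset)" using wf_hmem wf_not_refl by metis
qed

text \<open>Lets \<open>inv vreal\<close> decode reals.\<close>

lemma inj_vreal: "inj (vreal :: (nat \<Rightarrow> nat) \<Rightarrow> 'k hset)"
proof (rule injI)
  fix x y assume "vreal x = (vreal y :: 'k hset)"
  then have eq: "range (\<lambda>n. vpair (vnat n) (vnat (x n)) :: 'k hset) = range (\<lambda>n. vpair (vnat n) (vnat (y n)))"
    by (simp add: vreal_def vset_inject)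
  show "x = y"
  proof
    fix n
    have "(vpair (vnat n) (vnat (x n)) :: 'k hset) \<in> range (\<lambda>n. vpair (vnat n) (vnat (y n)))"
      unfolding eq[symmetric] by blast
    then show "x n = y n" by (auto simp: vpair_inject inj_eq[OF inj_vnat])
  qed
qed

end


section \<open>Ordinals\<close>

lemma vord_elts: "vord \<alpha> \<Longrightarrow> \<beta> \<in> elts \<alpha> \<Longrightarrow> vord \<beta>"
  unfolding vord_def vtransitive_def by blast

lemma vord_trans: "vord \<gamma> \<Longrightarrow> \<alpha> \<in> elts \<beta> \<Longrightarrow> \<beta> \<in> elts \<gamma> \<Longrightarrow> \<alpha> \<in> elts \<gamma>"
  by (auto simp: vord_def vtransitive_def)

text \<open>Double induction. If neither ordinal belongs to the other, each element of one is
  comparable with the other by induction, and transitivity leaves only membership; so both have the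
  same elements.\<close>

lemma vord_linear:
  "vord \<alpha> \<Longrightarrow> vord \<beta> \<Longrightarrow> \<alpha> \<in> elts \<beta> \<or> \<alpha> = \<beta> \<or> \<beta> \<in> elts \<alpha>"
proof (induction \<alpha> arbitrary: \<beta> rule: hset_induct)
  case IH\<alpha>: (1 \<alpha>)
  from IH\<alpha>.prems(2) show ?case
  proof (induction \<beta> rule: hset_induct)
    case IH\<beta>: (1 \<beta>)
    have "elts \<alpha> = elts \<beta>" if no: "\<alpha> \<notin> elts \<beta>" "\<beta> \<notin> elts \<alpha>"
    proof (intro equalityI subsetI)
      fix \<gamma> assume "\<gamma> \<in> elts \<alpha>"
      then show "\<gamma> \<in> elts \<beta>"
        using IH\<alpha>.IH[of \<gamma> \<beta>] IH\<alpha>.prems(1) IH\<beta>.prems no vord_elts vord_trans by metis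
    next
      fix \<gamma> assume "\<gamma> \<in> elts \<beta>"
      then show "\<gamma> \<in> elts \<alpha>"
        using IH\<beta>.IH[of \<gamma>] IH\<alpha>.prems(1) IH\<beta>.prems no vord_elts vord_trans by metis
    qed
    then show ?case using hset_eqI by blast
  qed
qed

lemma vord_subset_cases:
  assumes "vord \<alpha>" "vord \<beta>" "elts \<alpha> \<subseteq> elts \<beta>"
  shows "\<alpha> = \<beta> \<or> \<alpha> \<in> elts \<beta>"
  using vord_linear[OF assms(1,2)] assms(3) wf_not_refl[OF wf_hmem]
  by (auto simp: hmem_def)

lemma vord_subset_linear:
  assumes "vord \<alpha>" "vord \<beta>"
  shows "elts \<alpha> \<subseteq> elts \<beta> \<or> elts \<beta> \<subseteq> elts \<alpha>"
  using vord_linear[OF assms] assms by (auto simp: vord_def vtransitive_def)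


section \<open>Closed sets of countable subsets\<close>

text \<open>A set-valued operation on finite lists combines countably many finitary operations into
  one; the empty list supplies constants.\<close>

definition closed_under :: "('a list \<Rightarrow> 'a set) \<Rightarrow> 'a set \<Rightarrow> bool" where
  "closed_under G M \<longleftrightarrow> (\<forall>xs\<in>lists M. G xs \<subseteq> M)"

lemma lists_Union_mono:
  fixes Y :: "nat \<Rightarrow> 'a set"
  assumes "mono Y" "xs \<in> lists (\<Union>n. Y n)"
  shows "\<exists>n. xs \<in> lists (Y n)"
  using assms(2)
proof (induction xs)
  case (Cons x xs)
  then obtain m n where "x \<in> Y m" "xs \<in> lists (Y n)" by auto
  moreover have "Y m \<subseteq> Y (max m n)" "Y n \<subseteq> Y (max m n)"
    using assms(1) by (simp_all add: monoD)
  ultimately have "x # xs \<in> lists (Y (max m n))"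
    using lists_mono by auto
  then show ?case ..
qed simp

text \<open>Closing off in countably many stages gives unboundedness. Both there and for unions of
  chains, a finite list from the union already comes from one stage.\<close>

lemma club_closed_under:
  assumes G: "\<And>xs. xs \<in> lists A \<Longrightarrow> countable (G xs) \<and> G xs \<subseteq> A"
  shows "club A {M \<in> ctbl_subsets A. closed_under G M}"
  unfolding club_def
proof (intro conjI ballI allI impI)
  fix X assume X: "X \<in> ctbl_subsets A"
  define Y where "Y n = ((\<lambda>Z. Z \<union> (\<Union>xs\<in>lists Z. G xs)) ^^ n) X" for n
  have Y_Suc: "Y (Suc n) = Y n \<union> (\<Union>xs\<in>lists (Y n). G xs)" for n
    by (simp add: Y_def)
  have "mono Y" by (rule incseq_SucI) (auto simp: Y_Suc)
  have Y: "Y n \<subseteq> A \<and> countable (Y n)" for n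
  proof (induction n)
    case 0
    then show ?case using X by (simp add: Y_def ctbl_subsets_def)
  next
    case (Suc n)
    then have "lists (Y n) \<subseteq> lists A" using lists_mono by blast
    then have "countable (G xs) \<and> G xs \<subseteq> A" if "xs \<in> lists (Y n)" for xs
      using G that by (meson subsetD)
    moreover have "countable (lists (Y n))" using Suc by (intro countable_lists) simp
    ultimately show ?case unfolding Y_Suc using Suc by (simp add: UN_least)
  qed
  have "Y 0 = X" by (simp add: Y_def)
  then have sub: "X \<subseteq> (\<Union>n. Y n)" by blast
  moreover have "closed_under G (\<Union>n. Y n)"
    unfolding closed_under_def
  proof
    fix xs assume "xs \<in> lists (\<Union>n. Y n)"
    then obtain n where "xs \<in> lists (Y n)" using lists_Union_mono \<open>mono Y\<close> by blast
    then have "G xs \<subseteq> Y (Suc n)" by (auto simp: Y_Suc)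
    then show "G xs \<subseteq> (\<Union>n. Y n)" by blast
  qed
  moreover have "(\<Union>n. Y n) \<in> ctbl_subsets A"
    using Y X finite_subset[OF sub] by (auto simp: ctbl_subsets_def)
  ultimately show "\<exists>Z\<in>{M \<in> ctbl_subsets A. closed_under G M}. X \<subseteq> Z" by blast
next
  fix Y :: "nat \<Rightarrow> 'a set"
  assume Y: "range Y \<subseteq> {M \<in> ctbl_subsets A. closed_under G M} \<and> mono Y"
  then have Yn: "Y n \<subseteq> A" "countable (Y n)" "infinite (Y n)" "closed_under G (Y n)" for n
    by (auto simp: ctbl_subsets_def)
  have "closed_under G (\<Union>n. Y n)"
    unfolding closed_under_def
  proof
    fix xs assume "xs \<in> lists (\<Union>n. Y n)"
    then obtain n where "xs \<in> lists (Y n)" using lists_Union_mono Y by meson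
    then have "G xs \<subseteq> Y n" using Yn(4) by (simp add: closed_under_def)
    then show "G xs \<subseteq> (\<Union>n. Y n)" by blast
  qed
  moreover have "infinite (\<Union>n. Y n)"
    using Yn(3)[of 0] by (meson UN_upper UNIV_I infinite_super)
  moreover have "(\<Union>n. Y n) \<subseteq> A" "countable (\<Union>n. Y n)"
    using Yn(1,2) by blast+
  ultimately show "(\<Union>n. Y n) \<in> {M \<in> ctbl_subsets A. closed_under G M}"
    by (simp add: ctbl_subsets_def)
qed auto


section \<open>The construction along a pathway\<close>

locale pathway =
  fixes \<kappa> :: "'k rel" and W :: "'k hset rel" and f :: "'k hset \<Rightarrow> nat \<Rightarrow> nat"
    and S :: "'k hset set set"
  assumes pathway: "multiple_d_pathway \<kappa> W f S"
begin

lemma Card_order: "Card_order \<kappa>" and continuum_less: "continuum <o \<kappa>"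
  and stationary: "stationary (H \<kappa>) S"
  using pathway by (simp_all add: multiple_d_pathway_def)

lemma pathwayD:
  assumes "\<And>i. i \<le> n \<Longrightarrow> M i \<in> S" "delta_increasing n M"
    "projective (n + 2) R" "adequate (n + 1) R" "vrel (n + 2) R \<in> M n"
    "\<And>i. i \<le> n \<Longrightarrow> vreal (x i) \<in> M i"
  shows "(\<lambda>i\<in>{..<n + 2}. if i \<le> n then x i else f (height (M n))) \<in> R"
  using pathway assms unfolding multiple_d_pathway_def by blast

lemma continuum_ordLeq_UNIV: "continuum \<le>o |UNIV :: 'k set|"
proof -
  have "continuum \<le>o |Field \<kappa>|"
    using ordLess_imp_ordLeq[OF continuum_less] ordIso_symmetric[OF card_of_Field_ordIso[OF Card_order]]
    by (rule ordLeq_ordIso_trans)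
  then show ?thesis by (rule ordLeq_transitive) (rule card_of_mono1[OF subset_UNIV])
qed

lemmas elts_omega1' = elts_omega1[OF continuum_ordLeq_UNIV]
lemmas inj_vreal' = inj_vreal[OF continuum_ordLeq_UNIV]

lemma hered_continuum_subset_H: "hered_continuum \<subseteq> H \<kappa>"
  using ordLeq_ordLess_trans[OF _ continuum_less] by (auto simp: hered_continuum_def H_def)

lemma vreal_in_H: "vreal x \<in> H \<kappa>" and vrel_in_H: "vrel n R \<in> H \<kappa>"
  using hered_continuum_subset_H vreal_in_hered_continuum[OF continuum_ordLeq_UNIV]
    vrel_in_hered_continuum[OF continuum_ordLeq_UNIV] by blast+

lemma elts_in_H:
  assumes "y \<in> elts x" "x \<in> H \<kappa>"
  shows "y \<in> H \<kappa>"
proof -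
  have "trcl y \<subseteq> trcl x" using assms(1) trcl_eq[of x] by blast
  then show ?thesis
    using assms(2) ordLeq_ordLess_trans[OF card_of_mono1] by (auto simp: H_def)
qed

text \<open>The three clauses put into a model the relations to which the pathway is applied, the
  elements of its countable elements, and the complements of slices. Arguments that are not ordinals
  or codes of reals still give values in \<open>H \<kappa>\<close>.\<close>

definition hull_op :: "'k hset list \<Rightarrow> 'k hset set" where
  "hull_op xs = range (\<lambda>n. vrel (n + 2) (diag_rel n (map f xs))) \<union>
     (\<Union>x\<in>set xs. if countable (elts x) then elts x else {}) \<union>
     (\<Union>x\<in>set xs. range (\<lambda>l. vreal (of_slices (\<lambda>_. - slice (inv vreal x) l))))"

lemma hull_op_H: "xs \<in> lists (H \<kappa>) \<Longrightarrow> countable (hull_op xs) \<and> hull_op xs \<subseteq> H \<kappa>"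
  unfolding hull_op_def
  by (intro conjI countable_Un countable_UN)
    (auto simp: vreal_in_H vrel_in_H intro: elts_in_H countable_finite split: if_splits)

definition models :: "'k hset set set" where
  "models = {M \<in> S. closed_under hull_op M}"

text \<open>Adding \<open>vreal x\<close> as a constant to the operations still gives a club, which
  the stationary set \<open>S\<close> meets.\<close>

lemma ex_model: "\<exists>M\<in>models. vreal x \<in> M"
proof -
  let ?G = "\<lambda>xs. insert (vreal x) (hull_op xs)"
  have "club (H \<kappa>) {M \<in> ctbl_subsets (H \<kappa>). closed_under ?G M}"
    using hull_op_H vreal_in_H by (intro club_closed_under) auto
  then obtain M where "M \<in> S" "closed_under ?G M"
    using stationary unfolding stationary_def by blast
  moreover have "vreal x \<in> M"
    using \<open>closed_under ?G M\<close> lists.Nil unfolding closed_under_def by blast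
  ultimately show ?thesis by (auto simp: models_def closed_under_def)
qed

lemma models_hull_op: "M \<in> models \<Longrightarrow> xs \<in> lists M \<Longrightarrow> hull_op xs \<subseteq> M"
  by (simp add: models_def closed_under_def)

lemma countable_model: "M \<in> models \<Longrightarrow> countable M"
  using stationary by (auto simp: models_def stationary_def ctbl_subsets_def)

lemma elts_height: "M \<in> models \<Longrightarrow> elts (height M) = M \<inter> elts omega1"
  unfolding height_def
  by (intro elts_vset_countable[OF continuum_ordLeq_UNIV] countable_Int1 countable_model)

text \<open>A countable ordinal in \<open>M\<close> is included in \<open>M\<close> by the second
  clause of \<open>hull_op\<close>, so the height is transitive.\<close>

lemma height_in_omega1:
  assumes M: "M \<in> models"
  shows "height M \<in> elts omega1"
proof -
  have "elts \<alpha> \<subseteq> elts (height M)" if "\<alpha> \<in> elts (height M)" for \<alpha>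
  proof -
    have \<alpha>: "\<alpha> \<in> M" "vord \<alpha>" "countable (elts \<alpha>)"
      using that by (simp_all add: elts_height[OF M] elts_omega1')
    then have "elts \<alpha> \<subseteq> M"
      using models_hull_op[OF M, of "[\<alpha>]"] by (auto simp: hull_op_def)
    moreover have "elts \<alpha> \<subseteq> elts omega1"
    proof
      fix \<beta> assume \<beta>: "\<beta> \<in> elts \<alpha>"
      then have "elts \<beta> \<subseteq> elts \<alpha>" using \<alpha>(2) by (auto simp: vord_def vtransitive_def)
      then show "\<beta> \<in> elts omega1"
        using \<alpha> \<beta> vord_elts countable_subset by (auto simp: elts_omega1')
    qed
    ultimately show ?thesis by (simp add: elts_height[OF M])
  qed
  moreover have "countable (elts (height M))"
    by (simp add: elts_height[OF M] countable_model[OF M] countable_Int1)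
  moreover have "vtransitive \<alpha>" if "\<alpha> \<in> elts (height M)" for \<alpha>
    using that by (simp add: elts_height[OF M] elts_omega1' vord_def)
  ultimately show ?thesis
    by (simp add: elts_omega1' vord_def vtransitive_def)
qed

lemma vord_height: "M \<in> models \<Longrightarrow> vord (height M)"
  using height_in_omega1 by (auto simp: elts_omega1')

text \<open>The filter \<open>V\<close> is meant to be the one attached to \<delta> itself: the sets
  generated at \<delta> are fixed once it is chosen, and only ultrafilters at later stages have to
  contain them.\<close>

definition gen :: "'k hset \<Rightarrow> nat filter \<Rightarrow> nat set set" where
  "gen \<delta> V = {diag x (f \<delta>) | x. \<exists>M\<in>models. height M = \<delta> \<and> vreal x \<in> M \<and>
     (\<forall>l. \<forall>\<^sub>F j in V. j \<in> slice x l)}"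

text \<open>At the top height the slices are in \<open>U\<close>, at smaller heights the diagonal
  intersections are. So the first disjunct of \<open>diag_rel\<close> fails, and the pathway
  property yields the second.\<close>

lemma infinite_diag_Inter:
  fixes n :: nat
  assumes M: "\<And>i. i \<le> n \<Longrightarrow> M i \<in> models"
    and x: "\<And>i. i \<le> n \<Longrightarrow> vreal (x i) \<in> M i"
    and le: "\<And>i j. i \<le> j \<Longrightarrow> j \<le> n \<Longrightarrow> elts (height (M i)) \<subseteq> elts (height (M j))"
    and U: "nonprincipal_ultrafilter U"
    and slice: "\<And>i l. i \<le> n \<Longrightarrow> height (M i) = height (M n) \<Longrightarrow> \<forall>\<^sub>F j in U. j \<in> slice (x i) l"
    and diag: "\<And>i. i \<le> n \<Longrightarrow> height (M i) \<noteq> height (M n) \<Longrightarrow>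
      \<forall>\<^sub>F j in U. j \<in> diag (x i) (f (height (M i)))"
  shows "infinite {j. \<forall>i\<le>n. j \<in> diag (x i) (f (height (M i)))}"
proof -
  let ?\<delta> = "height (M n)"
  \<comment> \<open>Heights increase along the sequence, so those below the top one form an initial
    segment.\<close>
  define hts where "hts = takeWhile (\<lambda>\<alpha>. \<alpha> \<noteq> ?\<delta>) (map (height \<circ> M) [0..<Suc n])"
  have len: "length hts \<le> n"
  proof (rule ccontr)
    assume "\<not> length hts \<le> n"
    then have "hts ! n = ?\<delta>" "n < length hts"
      unfolding hts_def by (simp_all add: takeWhile_nth del: upt_Suc)
    then have "?\<delta> \<in> set hts" using nth_mem by metis
    then show False unfolding hts_def by (auto dest: set_takeWhileD)
  qed
  have old: "hts ! i = height (M i)" "height (M i) \<noteq> ?\<delta>" if "i < length hts" for i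
  proof -
    show eq: "hts ! i = height (M i)"
      using that len unfolding hts_def by (simp add: takeWhile_nth del: upt_Suc)
    have "hts ! i \<in> set hts" using that by simp
    then have "hts ! i \<noteq> ?\<delta>" unfolding hts_def by (blast dest: set_takeWhileD)
    then show "height (M i) \<noteq> ?\<delta>" using eq by simp
  qed
  have new: "height (M i) = ?\<delta>" if "\<not> i < length hts" "i \<le> n" for i
  proof (rule hset_eqI)
    have "height (M (length hts)) = ?\<delta>"
      using nth_length_takeWhile[of "\<lambda>\<alpha>. \<alpha> \<noteq> ?\<delta>" "map (height \<circ> M) [0..<Suc n]"] len
      unfolding hts_def[symmetric] by (simp del: upt_Suc)
    then have "elts ?\<delta> \<subseteq> elts (height (M i))" using le[of "length hts" i] that by simp
    then show "elts (height (M i)) = elts ?\<delta>" using le[of i n] that by simp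
  qed
  \<comment> \<open>A smaller height is an element of the top height, hence of \<open>M n\<close>;
    closure under \<open>hull_op\<close> then puts the relation with these parameters into
    \<open>M n\<close>.\<close>
  have "hts \<in> lists (M n)"
    unfolding in_lists_conv_set
  proof
    fix \<alpha> assume "\<alpha> \<in> set hts"
    then obtain i where i: "i < length hts" "\<alpha> = hts ! i" by (metis in_set_conv_nth)
    have i_le: "i \<le> n" using i(1) len by simp
    then have "elts (height (M i)) \<subseteq> elts ?\<delta>" using le by simp
    then have "height (M i) \<in> elts ?\<delta>"
      using vord_subset_cases vord_height[OF M] i_le old(2)[OF i(1)] by blast
    then show "\<alpha> \<in> M n"
      using i old(1) by (simp add: elts_height[OF M])
  qed
  then have rel: "vrel (n + 2) (diag_rel n (map f hts)) \<in> M n"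
    using models_hull_op[OF M[OF order_refl]] unfolding hull_op_def by blast
  define t where "t = (\<lambda>i\<in>{..<n + 2}. if i \<le> n then x i else f ?\<delta>)"
  have t: "t i = x i" if "i \<le> n" for i
    using that by (simp add: t_def)
  have t_Suc: "t (Suc n) = f ?\<delta>" by (simp add: t_def)
  have "t \<in> diag_rel n (map f hts)"
    unfolding t_def
  proof (rule pathwayD)
    show "delta_increasing n M" using le by (simp add: delta_increasing_def)
  qed (use M x rel projective_diag_rel adequate_diag_rel in \<open>auto simp: models_def\<close>)
  moreover have "\<not> (\<exists>k m. \<forall>j\<ge>m. \<exists>i\<le>n. \<exists>l\<le>k. j \<notin> past_slice (map f hts) t i l)"
  proof
    assume "\<exists>k m. \<forall>j\<ge>m. \<exists>i\<le>n. \<exists>l\<le>k. j \<notin> past_slice (map f hts) t i l"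
    then obtain k m where bad: "\<And>j. j \<ge> m \<Longrightarrow> \<exists>i\<le>n. \<exists>l\<le>k. j \<notin> past_slice (map f hts) t i l"
      by blast
    have "\<forall>\<^sub>F j in U. j \<in> past_slice (map f hts) t i l" if "i \<le> n" for i l
      using that slice[OF that new[OF _ that]] diag[OF that] old[of i]
      by (simp add: past_slice_def t)
    then have "\<forall>\<^sub>F j in U. \<forall>i\<in>{..n}. \<forall>l\<in>{..k}. j \<in> past_slice (map f hts) t i l"
      by (intro eventually_ball_finite ballI) auto
    then have "infinite {j. \<forall>i\<in>{..n}. \<forall>l\<in>{..k}. j \<in> past_slice (map f hts) t i l}"
      using nonprincipal_ultrafilter_imp_infinite[OF U] by simp
    then obtain j where "j \<ge> m" "\<forall>i\<in>{..n}. \<forall>l\<in>{..k}. j \<in> past_slice (map f hts) t i l"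
      unfolding infinite_nat_iff_unbounded_le by blast
    then show False using bad by (meson atMost_iff)
  qed
  ultimately have *: "\<forall>m. \<exists>j\<ge>m. \<forall>i\<le>n.
      j \<in> diag (t i) (if i < length hts then map f hts ! i else t (Suc n))"
    by (simp only: diag_rel_def mem_Collect_eq length_map simp_thms)
  have "diag (t i) (if i < length hts then map f hts ! i else t (Suc n)) =
      diag (x i) (f (height (M i)))" if "i \<le> n" for i
    using that old(1)[of i] new[of i] by (simp add: t t_Suc)
  with * show ?thesis
    unfolding infinite_nat_iff_unbounded_le by simp
qed

text \<open>Arranges finitely many generated sets by height for \<open>infinite_diag_Inter\<close>.
  The set \<open>D\<close> is \<open>elts \<alpha>\<close> at stage \<alpha> of the recursion and
  \<open>UNIV\<close> at its end.\<close>

lemma infinite_Inter_gen: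
  assumes V: "\<And>\<alpha>. \<alpha> \<in> D \<Longrightarrow> nonprincipal_ultrafilter (V \<alpha>) \<and>
      (\<forall>\<beta>\<in>elts \<alpha>. \<forall>A\<in>gen \<beta> (V \<beta>). \<forall>\<^sub>F j in V \<alpha>. j \<in> A)"
    and X: "X \<subseteq> (\<Union>\<alpha>\<in>D. gen \<alpha> (V \<alpha>))" "finite X"
  shows "infinite (\<Inter>X)"
proof (cases "X = {}")
  case False
  have "\<forall>A\<in>X. \<exists>M x. M \<in> models \<and> height M \<in> D \<and> A = diag x (f (height M)) \<and>
      vreal x \<in> M \<and> (\<forall>l. \<forall>\<^sub>F j in V (height M). j \<in> slice x l)"
    using X(1) by (fastforce simp: gen_def)
  then obtain M x where Mx: "\<And>A. A \<in> X \<Longrightarrow> M A \<in> models \<and> height (M A) \<in> D \<and>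
      A = diag (x A) (f (height (M A))) \<and> vreal (x A) \<in> M A \<and>
      (\<forall>l. \<forall>\<^sub>F j in V (height (M A)). j \<in> slice (x A) l)"
    by metis
  \<comment> \<open>A numerical sort key: counting the strictly smaller heights within
    \<open>X\<close> turns the inclusion order of heights into the order of numbers.\<close>
  define rank where "rank A = card {B \<in> X. elts (height (M B)) \<subset> elts (height (M A))}" for A
  have rank: "elts (height (M A)) \<subseteq> elts (height (M B))"
    if "A \<in> X" "B \<in> X" "rank A \<le> rank B" for A B
  proof (rule ccontr)
    assume "\<not> ?thesis"
    then have "elts (height (M B)) \<subset> elts (height (M A))"
      using vord_subset_linear vord_height Mx that by blast
    then have "rank B < rank A"
      unfolding rank_def using X(2) that(2) by (intro psubset_card_mono) auto
    with that show False by simp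
  qed
  obtain zs where zs: "set zs = X" using X(2) finite_list by blast
  define ys where "ys = sort_key rank zs"
  define n where "n = length ys - 1"
  have ys: "set ys = X" "sorted (map rank ys)" by (simp_all add: ys_def zs)
  then have "length ys = Suc n" using False by (cases ys) (auto simp: n_def)
  then have nth: "ys ! i \<in> X" if "i \<le> n" for i using ys(1) nth_mem that by fastforce
  have le: "elts (height (M (ys ! i))) \<subseteq> elts (height (M (ys ! j)))" if "i \<le> j" "j \<le> n" for i j
    using rank[OF nth nth] sorted_nth_mono[OF ys(2), of i j] that \<open>length ys = Suc n\<close> by simp
  let ?\<delta> = "height (M (ys ! n))"
  have "infinite {j. \<forall>i\<le>n. j \<in> diag (x (ys ! i)) (f (height (M (ys ! i))))}"
  \<comment> \<open>By coherence the ultrafilter at the largest height contains the sets generated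
    at smaller heights; at the largest height \<open>gen\<close> provides the slices.\<close>
  proof (rule infinite_diag_Inter[where U = "V ?\<delta>"])
    fix i assume i: "i \<le> n" "height (M (ys ! i)) \<noteq> ?\<delta>"
    then have "height (M (ys ! i)) \<in> elts ?\<delta>"
      using vord_subset_cases vord_height le[OF i(1) order_refl] Mx nth by blast
    moreover have "diag (x (ys ! i)) (f (height (M (ys ! i))))
        \<in> gen (height (M (ys ! i))) (V (height (M (ys ! i))))"
      unfolding gen_def using Mx[OF nth[OF i(1)]] by blast
    ultimately show "\<forall>\<^sub>F j in V ?\<delta>. j \<in> diag (x (ys ! i)) (f (height (M (ys ! i))))"
      using V[of ?\<delta>] Mx[OF nth[OF order_refl]] by blast
  next
    fix i l assume i: "i \<le> n" "height (M (ys ! i)) = ?\<delta>"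
    then show "\<forall>\<^sub>F j in V ?\<delta>. j \<in> slice (x (ys ! i)) l"
      using Mx[OF nth[OF i(1)]] by simp
  qed (use Mx nth V le in auto)
  moreover have "{j. \<forall>i\<le>n. j \<in> diag (x (ys ! i)) (f (height (M (ys ! i))))} \<subseteq> \<Inter>X"
  proof (intro subsetI InterI)
    fix j A assume j: "j \<in> {j. \<forall>i\<le>n. j \<in> diag (x (ys ! i)) (f (height (M (ys ! i))))}"
      and "A \<in> X"
    then obtain i where "i \<le> n" "A = ys ! i"
      using ys(1) \<open>length ys = Suc n\<close> by (metis in_set_conv_nth less_Suc_eq_le)
    with j have "j \<in> diag (x A) (f (height (M A)))" by blast
    moreover have "diag (x A) (f (height (M A))) = A" using Mx[OF \<open>A \<in> X\<close>] by blast
    ultimately show "j \<in> A" by (rule back_subst)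
  qed
  ultimately show ?thesis using infinite_super by blast
qed simp

text \<open>Recursion along membership over all sets, not only ordinals; \<open>gen \<beta>\<close>
  is empty unless \<beta> is the height of a model.\<close>

lemma ex_coherent_ultrafilters:
  "\<exists>V. \<forall>\<alpha>. nonprincipal_ultrafilter (V \<alpha>) \<and>
    (\<forall>\<beta>\<in>elts \<alpha>. \<forall>A\<in>gen \<beta> (V \<beta>). \<forall>\<^sub>F j in V \<alpha>. j \<in> A)"
proof -
  define P :: "('k hset \<Rightarrow> nat filter) \<Rightarrow> 'k hset \<Rightarrow> nat filter \<Rightarrow> bool" where
    "P V \<alpha> U \<longleftrightarrow> nonprincipal_ultrafilter U \<and>
      (\<forall>\<beta>\<in>elts \<alpha>. \<forall>A\<in>gen \<beta> (V \<beta>). \<forall>\<^sub>F j in U. j \<in> A)" for V \<alpha> U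
  have "\<exists>V. \<forall>\<alpha>. P V \<alpha> (V \<alpha>)"
  proof (rule dependent_wf_choice[OF wf_hmem])
    show "P V \<alpha> U = P V' \<alpha> U" if "\<And>\<beta>. (\<beta>, \<alpha>) \<in> hmem \<Longrightarrow> V \<beta> = V' \<beta>" for V V' \<alpha> U
      using that by (simp add: P_def hmem_def)
    show "\<exists>U. P V \<alpha> U" if "\<And>\<beta>. (\<beta>, \<alpha>) \<in> hmem \<Longrightarrow> P V \<beta> (V \<beta>)" for V \<alpha>
    proof -
      have "\<exists>U. nonprincipal_ultrafilter U \<and> (\<forall>A\<in>(\<Union>\<beta>\<in>elts \<alpha>. gen \<beta> (V \<beta>)). \<forall>\<^sub>F j in U. j \<in> A)"
        by (rule ex_nonprincipal_ultrafilter, rule infinite_Inter_gen[where D = "elts \<alpha>" and V = V])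
          (use that in \<open>auto simp: P_def hmem_def\<close>)
      then show ?thesis by (auto simp: P_def)
    qed
  qed
  then show ?thesis by (simp add: P_def)
qed

lemma ex_P_point: "\<exists>\<U>. P_point \<U>"
proof -
  obtain V where V: "\<And>\<alpha>. nonprincipal_ultrafilter (V \<alpha>) \<and>
      (\<forall>\<beta>\<in>elts \<alpha>. \<forall>A\<in>gen \<beta> (V \<beta>). \<forall>\<^sub>F j in V \<alpha>. j \<in> A)"
    using ex_coherent_ultrafilters by blast
  have "\<exists>\<U>. nonprincipal_ultrafilter \<U> \<and> (\<forall>A\<in>(\<Union>\<alpha>. gen \<alpha> (V \<alpha>)). \<forall>\<^sub>F j in \<U>. j \<in> A)"
    by (rule ex_nonprincipal_ultrafilter, rule infinite_Inter_gen[where D = UNIV and V = V])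
      (use V in auto)
  then obtain \<U> where U: "nonprincipal_ultrafilter \<U>"
    and gen: "\<And>\<alpha> A. A \<in> gen \<alpha> (V \<alpha>) \<Longrightarrow> \<forall>\<^sub>F j in \<U>. j \<in> A"
    by blast
  \<comment> \<open>\<open>gen\<close> asks for slices in \<open>V (height M)\<close>, whereas a
    P-point is about sets in \<U>. If a slice were missing from \<open>V (height M)\<close>, its
    complement would lead to a set in \<U> almost disjoint from the slice.\<close>
  have V_slice: "\<forall>\<^sub>F j in V (height M). j \<in> slice x l"
    if M: "M \<in> models" and x: "vreal x \<in> M" and l: "\<forall>\<^sub>F j in \<U>. j \<in> slice x l" for M x l
  proof (rule ccontr)
    assume "\<not> ?thesis"
    then have compl: "\<forall>\<^sub>F j in V (height M). j \<in> - slice x l"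
      using V[of "height M"] unfolding nonprincipal_ultrafilter_def by auto
    \<comment> \<open>The constant sequence of complements: its diagonal intersection is almost
      contained in the complement.\<close>
    let ?y = "of_slices (\<lambda>_. - slice x l)"
    have "vreal ?y \<in> M"
      using models_hull_op[OF M, of "[vreal x]"] x inv_f_f[OF inj_vreal', of x]
      by (auto simp: hull_op_def)
    then have "diag ?y (f (height M)) \<in> gen (height M) (V (height M))"
      unfolding gen_def using M compl by fastforce
    then have "\<forall>\<^sub>F j in \<U>. j \<in> diag ?y (f (height M))" by (rule gen)
    with l have "\<forall>\<^sub>F j in \<U>. j \<in> diag ?y (f (height M)) \<inter> slice x l"
      by eventually_elim simp
    then have "infinite (diag ?y (f (height M)) \<inter> slice x l)"
      by (rule nonprincipal_ultrafilter_imp_infinite[OF U])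
    moreover have "diag ?y (f (height M)) \<inter> slice x l = diag ?y (f (height M)) - slice ?y 0"
      by auto
    ultimately show False using finite_diag_minus_slice by metis
  qed
  have "\<exists>B. (\<forall>\<^sub>F j in \<U>. j \<in> B) \<and> (\<forall>A\<in>\<A>. finite (B - A))"
    if "countable \<A>" "\<forall>A\<in>\<A>. \<forall>\<^sub>F j in \<U>. j \<in> A" for \<A>
  proof -
    \<comment> \<open>Inserting \<open>UNIV\<close> permits an enumeration also when \<A> is
      empty.\<close>
    define A where "A = from_nat_into (insert UNIV \<A>)"
    have A: "range A = insert UNIV \<A>"
      using that(1) unfolding A_def by (intro range_from_nat_into) auto
    then have "A l \<in> insert UNIV \<A>" for l by blast
    then have UA: "\<forall>\<^sub>F j in \<U>. j \<in> A l" for l using that(2) by (metis always_eventually UNIV_I insertE)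
    obtain M where M: "M \<in> models" "vreal (of_slices A) \<in> M" using ex_model by blast
    have "\<forall>\<^sub>F j in V (height M). j \<in> slice (of_slices A) l" for l
      using V_slice[OF M] UA by simp
    then have "diag (of_slices A) (f (height M)) \<in> gen (height M) (V (height M))"
      unfolding gen_def using M by blast
    then have "\<forall>\<^sub>F j in \<U>. j \<in> diag (of_slices A) (f (height M))" by (rule gen)
    moreover have "finite (diag (of_slices A) (f (height M)) - B)" if "B \<in> \<A>" for B
    proof -
      have "B \<in> range A" using that by (simp add: A)
      then obtain l where "B = A l" by blast
      then show ?thesis
        using finite_diag_minus_slice[of "of_slices A" "f (height M)" l] by simp
    qed
    ultimately show ?thesis by blast
  qed
  then show ?thesis using U unfolding P_point_def by blast
qed

end

theorem theorem14:
  assumes "\<exists>(\<kappa> :: 'k rel) W f S. multiple_d_pathway \<kappa> W f S"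
  shows "\<exists>\<U> :: nat filter. P_point \<U>"
proof -
  obtain \<kappa> :: "'k rel" and W f S where "multiple_d_pathway \<kappa> W f S"
    using assms by blast
  then interpret pathway \<kappa> W f S by unfold_locales
  show ?thesis by (rule ex_P_point)
qed

end
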